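(* Let $r\ge 2$ and let $\mathcal{R}^{(r)}$ be the set of all $r$-partite $r$-patterns. Then \[ \frac{z_{\mathcal{R}^{(r)}}(\mathbb{RM}^{(r)}_{n})}{n}\longrightarrow \frac{(r-1)!}{r^{r-1}}\quad\text{in probability as } n\to\infty, \] i.e. $z_{\mathcal{R}^{(r)}}(\mathbb{RM}^{(r)}_{n})\sim\frac{(r-1)!}{r^{r-1}}n$ asymptotically almost surely.
   Context: An ordered $r$-matching of size $n$ is a set of $n$ pairwise disjoint $r$-element subsets (edges) of a linearly ordered set of $rn$ vertices (every vertex lies in an edge). Two ordered hypergraphs are order-isomorphic if there is an isomorphism between them preserving the linear orders. An $r$-pattern is an ordered $r$-matching of size 2 (up to order-isomorphism); it is written as a word of length $2r$ in letters $A,B$, each occurring $r$ times, beginning with $A$, where the positions of $A$ (resp. $B$) are the vertices of the first (resp. second) edge. An $r$-pattern is $r$-partite if it has the form $S_1S_2\cdots S_r$ with $S_1=AB$ and each $S_i\in\{AB,BA\}$. For a set $\mathcal{P}$ of $r$-patterns, a $\mathcal{P}$-clique is an ordered $r$-matching in which every pair of edges is order-isomorphic to a member of $\mathcal{P}$, and for an ordered $r$-matching $M$, $z_{\mathcal{P}}(M)$ denotes the maximum size of a $\mathcal{P}$-clique which is a sub-matching of $M$. $\mathbb{RM}^{(r)}_n$ denotes an ordered $r$-matching chosen uniformly at random among all ordered $r$-matchings on the vertex set $[rn]$ with its natural order. For random variables $X_n$ and a sequence $a_n$, $X_n\sim a_n$ means $X_n/a_n\to 1$ in probability. *)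

theory Defs
  imports "HOL-Probability.Probability"
begin

text \<open>
  An ordered hypergraph without isolated vertices is represented by its edge set; its vertex set
  is the union of the edges, ordered by the ambient linear order.
\<close>

definition ordered_matching :: "nat \<Rightarrow> 'a::linorder set set \<Rightarrow> bool" where
  "ordered_matching r M \<longleftrightarrow>
     finite M \<and> pairwise disjnt M \<and> (\<forall>e\<in>M. finite e \<and> card e = r)"

definition order_isomorphic :: "'a::linorder set set \<Rightarrow> 'b::linorder set set \<Rightarrow> bool" where
  "order_isomorphic E F \<longleftrightarrow>
     (\<exists>f. bij_betw f (\<Union>E) (\<Union>F) \<and> strict_mono_on (\<Union>E) f \<and> (\<lambda>e. f ` e) ` E = F)"

text \<open>
  \<open>LA\<close> and \<open>LB\<close> stand for the letters A and B.
\<close>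

datatype letter = LA | LB

definition is_pattern :: "nat \<Rightarrow> letter list \<Rightarrow> bool" where
  "is_pattern r w \<longleftrightarrow>
     length w = 2 * r \<and> count_list w LA = r \<and> count_list w LB = r \<and> w \<noteq> [] \<and> hd w = LA"

definition pattern_matching :: "letter list \<Rightarrow> nat set set" where
  "pattern_matching w =
     {{i. i < length w \<and> w ! i = LA}, {i. i < length w \<and> w ! i = LB}}"

definition is_partite :: "nat \<Rightarrow> letter list \<Rightarrow> bool" where
  "is_partite r w \<longleftrightarrow>
     (\<exists>S. length S = r \<and> S \<noteq> [] \<and> hd S = [LA, LB] \<and>
          set S \<subseteq> {[LA, LB], [LB, LA]} \<and> w = concat S)"

definition partite_patterns :: "nat \<Rightarrow> letter list set" where
  "partite_patterns r = {w. is_pattern r w \<and> is_partite r w}"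

definition pattern_clique :: "nat \<Rightarrow> letter list set \<Rightarrow> 'a::linorder set set \<Rightarrow> bool" where
  "pattern_clique r P M \<longleftrightarrow>
     ordered_matching r M \<and>
     (\<forall>e\<in>M. \<forall>f\<in>M. e \<noteq> f \<longrightarrow> (\<exists>w\<in>P. order_isomorphic {e, f} (pattern_matching w)))"

definition max_clique_size :: "nat \<Rightarrow> letter list set \<Rightarrow> 'a::linorder set set \<Rightarrow> nat" where
  "max_clique_size r P M = Max {card N |N. N \<subseteq> M \<and> pattern_clique r P N}"

definition matchings :: "nat \<Rightarrow> nat \<Rightarrow> nat set set set" where
  "matchings r n = {M. ordered_matching r M \<and> \<Union>M = {1..r * n} \<and> card M = n}"

definition random_matching :: "nat \<Rightarrow> nat \<Rightarrow> nat set set pmf" where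
  "random_matching r n = pmf_of_set (matchings r n)"

text \<open>
  Convergence in probability to a constant; the random variables \<open>X n\<close> may live on
  different probability spaces \<open>p n\<close>.
\<close>

definition tendsto_in_prob :: "(nat \<Rightarrow> 'a pmf) \<Rightarrow> (nat \<Rightarrow> 'a \<Rightarrow> real) \<Rightarrow> real \<Rightarrow> bool" where
  "tendsto_in_prob p X c \<longleftrightarrow>
     (\<forall>\<epsilon>>0. (\<lambda>n. measure_pmf.prob (p n) {x. \<bar>X n x - c\<bar> > \<epsilon>}) \<longlonglongrightarrow> 0)"

definition asymp_equiv_in_prob ::
    "(nat \<Rightarrow> 'a pmf) \<Rightarrow> (nat \<Rightarrow> 'a \<Rightarrow> real) \<Rightarrow> (nat \<Rightarrow> real) \<Rightarrow> bool" where
  "asymp_equiv_in_prob p X a \<longleftrightarrow> tendsto_in_prob p (\<lambda>n x. X n x / a n) 1"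

text \<open>
  \<open>pmf_of_set\<close> is the uniform distribution only on finite nonempty sets.
\<close>

lemma finite_matchings: "finite (matchings r n)"
proof (rule finite_subset)
  show "matchings r n \<subseteq> Pow (Pow {1..r * n})"
    by (auto simp: matchings_def)
qed simp

lemma matchings_nonempty:
  assumes "r \<ge> 1"
  shows "matchings r n \<noteq> {}"
proof -
  define e where "e = (\<lambda>i. {r * i + 1..r * i + r})"
  have inner: "{1..r * n} = (\<Union>i<n. e i)"
  proof (induction n)
    case (Suc n)
    have "{1..r * Suc n} = {1..r * n} \<union> e n"
      by (auto simp: e_def)
    then show ?case using Suc by (auto simp: lessThan_Suc)
  qed simp
  have disj: "disjnt (e i) (e j)" if "i < j" for i j
  proof -
    have "r * Suc i \<le> r * j" using that by (intro mult_le_mono2) simp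
    then show ?thesis by (auto simp: e_def disjnt_def)
  qed
  have disj': "disjnt (e i) (e j)" if "i \<noteq> j" for i j
    using disj[of i j] disj[of j i] that by (metis disjnt_sym linorder_neqE_nat)
  have ne: "e i \<noteq> {}" for i using assms by (auto simp: e_def)
  have inj: "inj_on e {..<n}"
    by (rule inj_onI) (metis disj' disjnt_self_iff_empty ne)
  have "ordered_matching r (e ` {..<n})"
    unfolding ordered_matching_def pairwise_def using disj'
    by (auto simp: e_def)
  then have "e ` {..<n} \<in> matchings r n"
    using inner inj by (auto simp: matchings_def card_image)
  then show ?thesis by blast
qed

end

theory Submission
  imports Defs
begin

text \<open>
  A matching is a clique for the partite patterns iff the vertex set splits into \<open>r\<close> consecutive
  intervals each of which meets every edge in exactly one vertex. For fixed intervals of lengths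
  \<open>l\<^sub>1, \<dots>, l\<^sub>r\<close> the expected number of transversal edges is \<open>l\<^sub>1 \<cdots> l\<^sub>r * n / (rn choose r)\<close>, which by
  AM-GM is largest for intervals of length \<open>n\<close>, and Chebyshev's inequality gives concentration.
  To control all interval partitions simultaneously, round the thresholds to multiples of some
  \<open>s \<approx> n / K\<close>: only boundedly many partitions remain, and at most \<open>r * s\<close> edges are affected.
\<close>

section \<open>Counting perfect matchings on arbitrary vertex sets\<close>

text \<open>Arbitrary vertex sets keep the family closed under deleting an edge together with its
  vertices, which drives the recursion for the count.\<close>

definition perfect_matchings :: "nat \<Rightarrow> 'a::linorder set \<Rightarrow> 'a set set set" where
  "perfect_matchings r V = {M. ordered_matching r M \<and> \<Union>M = V}"

text \<open>The probability that a given \<open>r\<close>-set of vertices is an edge of the random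
  matching: by symmetry its \<open>n\<close> edges are spread evenly over all
  \<open>r\<close>-sets.\<close>

definition edge_prob :: "nat \<Rightarrow> nat \<Rightarrow> real" where
  "edge_prob r n = real n / real ((r * n) choose r)"

lemma card_perfect_matching:
  assumes "M \<in> perfect_matchings r V"
  shows "card V = r * card M"
proof -
  have "card (\<Union>M) = sum card M"
    using assms by (intro card_Union_disjoint)
      (auto simp: perfect_matchings_def ordered_matching_def)
  then show ?thesis
    using assms by (simp add: perfect_matchings_def ordered_matching_def)
qed

lemma matchings_eq_perfect_matchings:
  assumes "r \<ge> 1"
  shows "matchings r n = perfect_matchings r {1..r * n}"
  using assms card_perfect_matching[of _ r "{1..r * n}"]
  by (auto simp: matchings_def perfect_matchings_def)

lemma finite_perfect_matchings:
  assumes "finite V"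
  shows "finite (perfect_matchings r V)"
  by (rule finite_subset[of _ "Pow (Pow V)"])
    (use assms in \<open>auto simp: perfect_matchings_def\<close>)

lemma perfect_matchings_remove:
  assumes "M \<in> perfect_matchings r V" "e \<in> M"
  shows "M - {e} \<in> perfect_matchings r (V - e)"
proof -
  have M: "ordered_matching r M" "\<Union>M = V"
    using assms(1) by (auto simp: perfect_matchings_def)
  then have "disjnt f e" if "f \<in> M - {e}" for f
    using that assms(2) by (auto simp: ordered_matching_def pairwise_def)
  then have "\<Union>(M - {e}) = V - e"
    using M(2) by (fastforce simp: disjnt_def)
  moreover have "ordered_matching r (M - {e})"
    using M(1) by (auto simp: ordered_matching_def intro: pairwise_subset)
  ultimately show ?thesis by (simp add: perfect_matchings_def)
qed

text \<open>Deleting \<open>e\<close> and inserting it again are mutually inverse;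
  \<open>r \<ge> 1\<close> makes \<open>e\<close> nonempty, so it cannot already be an edge on
  \<open>V - e\<close>.\<close>

lemma card_perfect_matchings_containing:
  assumes "r \<ge> 1" "e \<subseteq> V" "card e = r"
  shows "card {M \<in> perfect_matchings r V. e \<in> M} = card (perfect_matchings r (V - e))"
proof -
  have fin: "finite e" and ne: "e \<noteq> {}" using assms by (auto intro: card_ge_0_finite)
  have "bij_betw (\<lambda>M. M - {e}) {M \<in> perfect_matchings r V. e \<in> M} (perfect_matchings r (V - e))"
  proof (rule bij_betwI[where g = "insert e"])
    show "(\<lambda>M. M - {e}) \<in> {M \<in> perfect_matchings r V. e \<in> M} \<rightarrow> perfect_matchings r (V - e)"
      by (auto intro: perfect_matchings_remove)
    show "insert e \<in> perfect_matchings r (V - e) \<rightarrow> {M \<in> perfect_matchings r V. e \<in> M}"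
    proof
      fix M assume "M \<in> perfect_matchings r (V - e)"
      then have M: "ordered_matching r M" "\<Union>M = V - e"
        by (auto simp: perfect_matchings_def)
      then have "\<And>f. f \<in> M \<Longrightarrow> disjnt e f" by (auto simp: disjnt_def)
      then have "ordered_matching r (insert e M)"
        using M(1) assms(3) fin by (auto simp: ordered_matching_def pairwise_insert disjnt_sym)
      then show "insert e M \<in> {M \<in> perfect_matchings r V. e \<in> M}"
        using M(2) assms(2) by (auto simp: perfect_matchings_def)
    qed
    show "insert e M - {e} = M" if "M \<in> perfect_matchings r (V - e)" for M
      using that ne by (auto simp: perfect_matchings_def)
  qed auto
  then show ?thesis by (rule bij_betw_same_card)
qed

lemma perfect_matchings_empty:
  assumes "r \<ge> 1"
  shows "perfect_matchings r ({} :: 'a::linorder set) = {{}}"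
proof (intro equalityI subsetI)
  fix M assume M: "M \<in> perfect_matchings r ({} :: 'a set)"
  have "M = {}"
  proof (rule ccontr)
    assume "M \<noteq> {}"
    then obtain e where "e \<in> M" by blast
    with M have "e = {}" "card e = r"
      by (auto simp: perfect_matchings_def ordered_matching_def)
    then show False using assms by simp
  qed
  then show "M \<in> {{}}" by simp
qed (auto simp: perfect_matchings_def ordered_matching_def)

text \<open>Double counting of the pairs \<open>(M, e)\<close> with
  \<open>e \<in> M \<inter> T\<close>. It serves the enumeration of matchings as well as both
  moments.\<close>

lemma sum_card_Int_eq:
  assumes "finite A" "finite T"
  shows "(\<Sum>M\<in>A. real (card (M \<inter> T))) = (\<Sum>e\<in>T. real (card {M\<in>A. e \<in> M}))"
proof -
  have "(\<Sum>M\<in>A. real (card (M \<inter> T))) = (\<Sum>M\<in>A. \<Sum>e\<in>T. if e \<in> M then 1 else 0)"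
    using assms by (simp add: sum.If_cases Int_commute)
  also have "\<dots> = (\<Sum>e\<in>T. \<Sum>M\<in>A. if e \<in> M then 1 else 0)"
    by (rule sum.swap)
  also have "\<dots> = (\<Sum>e\<in>T. real (card {M\<in>A. e \<in> M}))"
    using assms by (simp add: sum.If_cases Int_def)
  finally show ?thesis .
qed

text \<open>Counting pairs of a matching and one of its edges in two ways gives the recursion: a
  matching of size \<open>n + 1\<close> has \<open>n + 1\<close> edges, and an \<open>r\<close>-set
  \<open>e\<close> lies in as many matchings as there are on \<open>V - e\<close>.\<close>

lemma card_perfect_matchings:
  assumes "r \<ge> 1" "finite V" "card V = r * n"
  shows "real (card (perfect_matchings r V)) = (\<Prod>k=1..n. real ((r * k) choose r) / real k)"
  using assms(2,3)
proof (induction n arbitrary: V)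
  case 0
  then show ?case by (simp add: perfect_matchings_empty[OF assms(1)])
next
  case (Suc n)
  let ?E = "{e. e \<subseteq> V \<and> card e = r}"
  let ?f = "\<Prod>k=1..n. real ((r * k) choose r) / real k"
  have finE: "finite ?E" using Suc.prems by (auto intro: finite_subset[of _ "Pow V"])
  have cardE: "card ?E = (r * Suc n) choose r"
    using n_subsets[OF Suc.prems(1), of r] Suc.prems by simp
  have "real (Suc n) * real (card (perfect_matchings r V))
      = (\<Sum>M\<in>perfect_matchings r V. real (card (M \<inter> ?E)))"
  proof -
    have "card (M \<inter> ?E) = Suc n" if "M \<in> perfect_matchings r V" for M
    proof -
      have "M \<inter> ?E = M"
        using that by (auto simp: perfect_matchings_def ordered_matching_def)
      moreover have "r * card M = r * Suc n"
        using card_perfect_matching[OF that] Suc.prems by simp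
      ultimately show ?thesis using assms(1) by (simp del: mult_Suc_right)
    qed
    then show ?thesis by simp
  qed
  also have "\<dots> = (\<Sum>e\<in>?E. real (card {M\<in>perfect_matchings r V. e \<in> M}))"
    by (rule sum_card_Int_eq[OF finite_perfect_matchings[OF Suc.prems(1)] finE])
  also have "\<dots> = (\<Sum>e\<in>?E. ?f)"
  proof (rule sum.cong[OF refl])
    fix e assume e: "e \<in> ?E"
    then have "card (V - e) = r * n"
      using Suc.prems by (subst card_Diff_subset) (auto intro: finite_subset)
    then show "real (card {M\<in>perfect_matchings r V. e \<in> M}) = ?f"
      using e Suc.IH[of "V - e"] Suc.prems card_perfect_matchings_containing[OF assms(1), of e V]
      by auto
  qed
  also have "\<dots> = real ((r * Suc n) choose r) * ?f"
    using cardE by simp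
  finally have "real (Suc n) * real (card (perfect_matchings r V))
      = real ((r * Suc n) choose r) * ?f" .
  then have "real (card (perfect_matchings r V)) = real ((r * Suc n) choose r) * ?f / real (Suc n)"
    by (simp add: field_simps)
  then show ?case by simp
qed

lemma edge_prob_pos:
  assumes "r \<ge> 1" "n \<ge> 1"
  shows "edge_prob r n > 0"
  using assms by (auto simp: edge_prob_def)

text \<open>The product formulas for \<open>n\<close> and \<open>n - 1\<close> differ in a single
  factor, the reciprocal of \<open>edge_prob r n\<close>.\<close>

lemma card_perfect_matchings_Diff:
  assumes "r \<ge> 1" "finite V" "card V = r * n" "n \<ge> 1" "e \<subseteq> V" "card e = r"
  shows "real (card (perfect_matchings r (V - e)))
    = edge_prob r n * real (card (perfect_matchings r V))"
proof -
  obtain m where m: "n = Suc m" using assms(4) by (cases n) auto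
  have "finite e" using assms(2,5) by (rule finite_subset[rotated])
  then have "card (V - e) = r * m"
    using assms m by (simp add: card_Diff_subset)
  moreover have "real ((r * Suc m) choose r) > 0" using assms(1) by simp
  ultimately show ?thesis
    using card_perfect_matchings[OF assms(1), of "V - e" m]
      card_perfect_matchings[OF assms(1), of V n] assms(2,3)
    by (simp add: m edge_prob_def del: mult_Suc_right)
qed

section \<open>Probabilities of one or two prescribed edges\<close>

lemma card_matchings_containing:
  assumes "r \<ge> 1" "n \<ge> 1" "e \<subseteq> {1..r * n}" "card e = r"
  shows "real (card {M \<in> matchings r n. e \<in> M}) = edge_prob r n * real (card (matchings r n))"
  using assms card_perfect_matchings_containing[of r e "{1..r * n}"]
    card_perfect_matchings_Diff[of r "{1..r * n}" n e]
  by (simp add: matchings_eq_perfect_matchings)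

text \<open>Distinct edges that meet never occur together. For disjoint ones, removing
  \<open>e\<close> and then \<open>f\<close> costs one factor each, the second for matchings with
  \<open>n - 1\<close> edges.\<close>

lemma card_matchings_containing2:
  assumes "r \<ge> 1" "n \<ge> 2" "e \<subseteq> {1..r * n}" "card e = r" "f \<subseteq> {1..r * n}" "card f = r" "e \<noteq> f"
  shows "real (card {M \<in> matchings r n. e \<in> M \<and> f \<in> M})
    \<le> edge_prob r n * edge_prob r (n - 1) * real (card (matchings r n))"
proof (cases "disjnt e f")
  case False
  then have "{M \<in> matchings r n. e \<in> M \<and> f \<in> M} = {}"
    using assms(7) by (auto simp: matchings_def ordered_matching_def pairwise_def)
  moreover have "edge_prob r n * edge_prob r (n - 1) \<ge> 0" by (simp add: edge_prob_def)
  ultimately show ?thesis by (simp del: Collect_empty_eq)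
next
  case True
  let ?V = "{1..r * n}"
  have fe: "f \<subseteq> ?V - e" using True assms(5) by (auto simp: disjnt_def)
  have fine: "finite e" using assms(3) by (rule finite_subset) simp
  have cVe: "card (?V - e) = r * (n - 1)"
    using assms fine by (simp add: card_Diff_subset diff_mult_distrib2)
  have "card {M \<in> matchings r n. e \<in> M \<and> f \<in> M} \<le> card {M \<in> perfect_matchings r (?V - e). f \<in> M}"
  proof (rule card_inj_on_le[where f = "\<lambda>M. M - {e}"])
    show "inj_on (\<lambda>M. M - {e}) {M \<in> matchings r n. e \<in> M \<and> f \<in> M}"
      by (auto simp: inj_on_def)
    show "(\<lambda>M. M - {e}) ` {M \<in> matchings r n. e \<in> M \<and> f \<in> M} \<subseteq> {M \<in> perfect_matchings r (?V - e). f \<in> M}"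
      using assms(1,7)
      by (auto simp: matchings_eq_perfect_matchings intro: perfect_matchings_remove)
    show "finite {M \<in> perfect_matchings r (?V - e). f \<in> M}"
      by (simp add: finite_perfect_matchings)
  qed
  also have "\<dots> = card (perfect_matchings r (?V - e - f))"
    by (rule card_perfect_matchings_containing) (use assms fe in auto)
  finally have "real (card {M \<in> matchings r n. e \<in> M \<and> f \<in> M}) \<le> real (card (perfect_matchings r (?V - e - f)))"
    by simp
  also have "\<dots> = edge_prob r (n - 1) * real (card (perfect_matchings r (?V - e)))"
    by (rule card_perfect_matchings_Diff) (use assms fe cVe in auto)
  also have "real (card (perfect_matchings r (?V - e))) = edge_prob r n * real (card (perfect_matchings r ?V))"
    by (rule card_perfect_matchings_Diff) (use assms in auto)
  finally show ?thesis using assms(1) by (simp add: matchings_eq_perfect_matchings mult_ac)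
qed

section \<open>Variance and Chebyshev's inequality\<close>

text \<open>Summing over ordered pairs of edges bounds the variance by
  \<open>\<mu> + \<mu>\<^sup>2 * (?q / ?p - 1)\<close>, where \<open>\<mu>\<close> is the mean. As
  \<open>\<mu>\<close> is at most \<open>n\<close> and the ratio tends to 1, this is of smaller
  order than the square of \<open>n\<close>.\<close>

lemma second_moment_bound:
  assumes r: "r \<ge> 1" and n: "n \<ge> 2" and T: "T \<subseteq> {e. e \<subseteq> {1..r * n} \<and> card e = r}"
  shows "(\<Sum>M\<in>matchings r n. (real (card (M \<inter> T)) - real (card T) * edge_prob r n)\<^sup>2)
    \<le> real (card (matchings r n)) * (real n + (real n)\<^sup>2 * \<bar>edge_prob r (n - 1) / edge_prob r n - 1\<bar>)"
proof -
  let ?A = "matchings r n" and ?p = "edge_prob r n" and ?q = "edge_prob r (n - 1)"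
  let ?m = "real (card ?A)" and ?t = "real (card T)"
  have finA: "finite ?A" by (rule finite_matchings)
  have finP: "finite {e. e \<subseteq> {1..r * n} \<and> card e = r}"
    by (auto intro: finite_subset[of _ "Pow {1..r * n}"])
  have finT: "finite T" by (rule finite_subset[OF T finP])
  have p: "?p > 0" using edge_prob_pos r n by simp
  have first: "(\<Sum>M\<in>?A. real (card (M \<inter> T))) = ?t * ?p * ?m"
  proof -
    have "(\<Sum>M\<in>?A. real (card (M \<inter> T))) = (\<Sum>e\<in>T. ?p * ?m)"
      unfolding sum_card_Int_eq[OF finA finT]
      by (rule sum.cong[OF refl], rule card_matchings_containing) (use r n T in auto)
    then show ?thesis by simp
  qed
  have "(\<Sum>M\<in>?A. (real (card (M \<inter> T)))\<^sup>2) = (\<Sum>M\<in>?A. real (card (M \<inter> T) * card (M \<inter> T)))"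
    by (simp add: power2_eq_square)
  also have "\<dots> = (\<Sum>M\<in>?A. real (card ((M \<times> M) \<inter> (T \<times> T))))"
    by (simp add: Times_Int_Times card_cartesian_product)
  \<comment> \<open>Replacing each \<open>M\<close> by \<open>M \<times> M\<close>, an injective
    change, turns the double count of edges into one of ordered pairs of edges.\<close>
  also have "\<dots> = (\<Sum>P\<in>(\<lambda>M. M \<times> M) ` ?A. real (card (P \<inter> (T \<times> T))))"
    by (subst sum.reindex) (auto simp: inj_on_def)
  also have "\<dots> = (\<Sum>ef\<in>T \<times> T. real (card {P \<in> (\<lambda>M. M \<times> M) ` ?A. ef \<in> P}))"
    by (rule sum_card_Int_eq) (use finA finT in auto)
  \<comment> \<open>The summand meant for distinct edges is added on the diagonal too; this only
    weakens the bound and lets the sum factor.\<close>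
  also have "\<dots> \<le> (\<Sum>(e, f)\<in>T \<times> T. (if e = f then ?p * ?m else 0) + ?p * ?q * ?m)"
  proof (rule sum_mono, clarify)
    fix e f assume ef: "e \<in> T" "f \<in> T"
    have "{P \<in> (\<lambda>M. M \<times> M) ` ?A. (e, f) \<in> P} = (\<lambda>M. M \<times> M) ` {M \<in> ?A. e \<in> M \<and> f \<in> M}"
      by auto
    moreover have inj: "inj_on (\<lambda>M. M \<times> M) {M \<in> ?A. e \<in> M \<and> f \<in> M}"
      by (auto simp: inj_on_def)
    ultimately have *: "card {P \<in> (\<lambda>M. M \<times> M) ` ?A. (e, f) \<in> P} = card {M \<in> ?A. e \<in> M \<and> f \<in> M}"
      by (simp only: card_image[OF inj])
    have "?p * ?q * ?m \<ge> 0" by (simp add: edge_prob_def)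
    then show "real (card {P \<in> (\<lambda>M. M \<times> M) ` ?A. (e, f) \<in> P})
        \<le> (if e = f then ?p * ?m else 0) + ?p * ?q * ?m"
      unfolding * using card_matchings_containing[of r n e] card_matchings_containing2[of r n e f]
        r n T ef by (auto simp: subset_iff)
  qed
  also have "\<dots> = ?t * ?p * ?m + ?t * ?t * ?p * ?q * ?m"
    using finT by (simp add: sum.cartesian_product[symmetric] sum.distrib algebra_simps)
  finally have second: "(\<Sum>M\<in>?A. (real (card (M \<inter> T)))\<^sup>2)
      \<le> ?t * ?p * ?m + ?t * ?t * ?p * ?q * ?m" .
  define \<mu> where "\<mu> = ?t * ?p"
  \<comment> \<open>All \<open>r\<close>-sets together have expectation \<open>n\<close>, so
    \<open>T\<close> has at most that.\<close>
  have "card T \<le> (r * n) choose r"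
    using card_mono[OF finP T] n_subsets[of "{1..r * n}" r] by simp
  then have "\<mu> \<le> real ((r * n) choose r) * ?p"
    unfolding \<mu>_def using p by (intro mult_right_mono) auto
  also have "\<dots> \<le> real n" by (simp add: edge_prob_def)
  finally have \<mu>: "0 \<le> \<mu>" "\<mu> \<le> real n" using p by (auto simp: \<mu>_def)
  have "(\<Sum>M\<in>?A. (real (card (M \<inter> T)) - \<mu>)\<^sup>2)
      = (\<Sum>M\<in>?A. (real (card (M \<inter> T)))\<^sup>2) - 2 * \<mu> * (\<Sum>M\<in>?A. real (card (M \<inter> T))) + \<mu>\<^sup>2 * ?m"
    by (simp add: power2_diff sum.distrib sum_subtractf sum_distrib_left algebra_simps)
  also have "\<dots> \<le> (\<mu> * ?m + \<mu> * ?t * ?q * ?m) - 2 * \<mu> * (\<mu> * ?m) + \<mu>\<^sup>2 * ?m"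
    using first second by (simp add: \<mu>_def mult_ac)
  also have "\<dots> = ?m * (\<mu> + \<mu>\<^sup>2 * (?q / ?p - 1))"
    using p by (simp add: \<mu>_def power2_eq_square field_simps)
  also have "\<dots> \<le> ?m * (real n + (real n)\<^sup>2 * \<bar>?q / ?p - 1\<bar>)"
    by (intro mult_left_mono add_mono mult_mono power_mono \<mu> order.trans[OF mult_left_mono[OF abs_ge_self]]) auto
  finally show ?thesis by (simp add: \<mu>_def)
qed

text \<open>Chebyshev's inequality in counting form: each deviating matching contributes at least
  \<open>(\<epsilon> * real n)\<^sup>2\<close> to the sum of squares. The bound is the same for all
  \<open>T\<close>, which suits the later union bound.\<close>

lemma prob_deviation_le:
  assumes r: "r \<ge> 1" and n: "n \<ge> 2" and T: "T \<subseteq> {e. e \<subseteq> {1..r * n} \<and> card e = r}"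
    and \<epsilon>: "\<epsilon> > 0"
  shows "measure_pmf.prob (random_matching r n)
      {M. \<bar>real (card (M \<inter> T)) - real (card T) * edge_prob r n\<bar> > \<epsilon> * real n}
    \<le> (1 / real n + \<bar>edge_prob r (n - 1) / edge_prob r n - 1\<bar>) / \<epsilon>\<^sup>2"
proof -
  let ?A = "matchings r n"
  define d where "d M = real (card (M \<inter> T)) - real (card T) * edge_prob r n" for M
  let ?S = "{M. \<bar>d M\<bar> > \<epsilon> * real n}"
  have A: "finite ?A" "?A \<noteq> {}" using finite_matchings matchings_nonempty[OF r] by auto
  then have cA: "real (card ?A) > 0" by (simp add: card_gt_0_iff)
  have "real (card (?A \<inter> ?S)) * (\<epsilon> * real n)\<^sup>2 = (\<Sum>M\<in>?A \<inter> ?S. (\<epsilon> * real n)\<^sup>2)"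
    by simp
  also have "\<dots> \<le> (\<Sum>M\<in>?A \<inter> ?S. (d M)\<^sup>2)"
    by (intro sum_mono abs_le_square_iff[THEN iffD1]) (use \<epsilon> in auto)
  also have "\<dots> \<le> (\<Sum>M\<in>?A. (d M)\<^sup>2)"
    by (rule sum_mono2) (use A in auto)
  also have "\<dots> \<le> real (card ?A) * (real n + (real n)\<^sup>2 * \<bar>edge_prob r (n - 1) / edge_prob r n - 1\<bar>)"
    unfolding d_def by (rule second_moment_bound[OF r n T])
  finally have "(real (card (?A \<inter> ?S)) * \<epsilon>\<^sup>2) * (real n)\<^sup>2
      \<le> (real (card ?A) * (1 / real n + \<bar>edge_prob r (n - 1) / edge_prob r n - 1\<bar>)) * (real n)\<^sup>2"
    using n by (simp add: algebra_simps power2_eq_square)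
  then have "real (card (?A \<inter> ?S)) * \<epsilon>\<^sup>2
      \<le> real (card ?A) * (1 / real n + \<bar>edge_prob r (n - 1) / edge_prob r n - 1\<bar>)"
    by (rule mult_right_le_imp_le) (use n in simp)
  then have "real (card (?A \<inter> ?S)) / real (card ?A)
      \<le> (1 / real n + \<bar>edge_prob r (n - 1) / edge_prob r n - 1\<bar>) / \<epsilon>\<^sup>2"
    using cA \<epsilon> by (simp add: field_simps)
  then show ?thesis
    using A by (simp add: random_matching_def measure_pmf_of_set d_def)
qed

section \<open>Sorted edges and transversals of interval systems\<close>

abbreviation nth_vertex :: "'a::linorder set \<Rightarrow> nat \<Rightarrow> 'a" where
  "nth_vertex e i \<equiv> sorted_list_of_set e ! i"

lemma nth_vertex_image:
  assumes "finite e"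
  shows "nth_vertex e ` {..<card e} = e"
proof -
  have "nth_vertex e ` {..<card e} = set (sorted_list_of_set e)"
    by (auto simp: set_conv_nth)
  then show ?thesis using assms by simp
qed

lemma nth_vertex_mem:
  assumes "finite e" "i < card e"
  shows "nth_vertex e i \<in> e"
  using assms nth_mem[of i "sorted_list_of_set e"] by simp

lemma nth_vertex_eqI:
  assumes "strict_mono_on {..<r} g" "e = g ` {..<r}" "i < r"
  shows "nth_vertex e i = g i"
proof -
  have "sorted_wrt (<) (map g [0..<r])"
    using assms(1) by (auto simp: sorted_wrt_iff_nth_less strict_mono_on_def)
  moreover have "set (map g [0..<r]) = e" using assms(2) by (auto simp: lessThan_atLeast0)
  ultimately have "sorted_list_of_set e = map g [0..<r]"
    using sorted_list_of_set_unique[of e "map g [0..<r]"] assms(1,2)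
    by (auto simp: card_image strict_mono_on_imp_inj_on)
  then show ?thesis using assms(3) by simp
qed

text \<open>The thresholds \<open>b 0, ..., b r\<close> cut out half-open intervals, and a
  transversal takes one point from each. Extensional choice functions make the number of choices a
  product.\<close>

definition transversals :: "nat \<Rightarrow> (nat \<Rightarrow> nat) \<Rightarrow> nat set set" where
  "transversals r b = (\<lambda>g. g ` {..<r}) ` (\<Pi>\<^sub>E i\<in>{..<r}. {b i<..b (Suc i)})"

lemma transversalsI:
  assumes "\<And>i. i < r \<Longrightarrow> g i \<in> {b i<..b (Suc i)}"
  shows "g ` {..<r} \<in> transversals r b"
proof -
  have "g ` {..<r} = restrict g {..<r} ` {..<r}" by auto
  moreover have "restrict g {..<r} \<in> (\<Pi>\<^sub>E i\<in>{..<r}. {b i<..b (Suc i)})"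
    using assms by auto
  ultimately show ?thesis unfolding transversals_def by blast
qed

lemma transversalsE:
  assumes "e \<in> transversals r b"
  obtains g where "e = g ` {..<r}" "\<And>i. i < r \<Longrightarrow> b i < g i" "\<And>i. i < r \<Longrightarrow> g i \<le> b (Suc i)"
  using assms unfolding transversals_def by (auto simp: PiE_iff)

lemma monotone_chain:
  assumes "\<And>i. i < r \<Longrightarrow> b i \<le> b (Suc i)" "i \<le> j" "j \<le> r"
  shows "(b i :: 'a::order) \<le> b j"
  using assms(2,3)
proof (induction j rule: dec_induct)
  case (step m)
  then show ?case using assms(1)[of m] by (meson Suc_le_eq less_imp_le order.trans)
qed simp

lemma strict_mono_on_interlaced:
  fixes b :: "nat \<Rightarrow> nat"
  assumes "\<And>i. i < r \<Longrightarrow> b i < g i" "\<And>i. i < r \<Longrightarrow> g i \<le> b (Suc i)"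
  shows "strict_mono_on {..<r} g"
proof (rule strict_mono_onI)
  fix i j assume ij: "i \<in> {..<r}" "j \<in> {..<r}" "i < j"
  have mono: "b k \<le> b (Suc k)" if "k < r" for k
    using assms[OF that] by simp
  have "g i \<le> b (Suc i)" using assms(2) ij by simp
  also have "\<dots> \<le> b j" by (rule monotone_chain[where r = r]) (use ij mono in auto)
  also have "\<dots> < g j" using assms(1) ij by simp
  finally show "g i < g j" .
qed

lemma transversals_subset:
  assumes "b r \<le> m"
  shows "transversals r b \<subseteq> {e. e \<subseteq> {1..m} \<and> card e = r}"
proof
  fix e assume "e \<in> transversals r b"
  then obtain g where g: "e = g ` {..<r}" "\<And>i. i < r \<Longrightarrow> b i < g i" "\<And>i. i < r \<Longrightarrow> g i \<le> b (Suc i)"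
    by (rule transversalsE) blast
  have "inj_on g {..<r}"
    using strict_mono_on_interlaced[of r b g] g(2,3) strict_mono_on_imp_inj_on by blast
  then have "card e = r" using g(1) by (simp add: card_image)
  moreover have "g i \<in> {1..m}" if "i < r" for i
  proof -
    have "b k \<le> b (Suc k)" if "k < r" for k using g(2,3)[OF that] by simp
    then have "b (Suc i) \<le> b r" by (rule monotone_chain[where r = r]) (use \<open>i < r\<close> in auto)
    then show ?thesis using g(2,3)[OF that] assms by auto
  qed
  ultimately show "e \<in> {e. e \<subseteq> {1..m} \<and> card e = r}" using g(1) by auto
qed

text \<open>Interlacing makes a choice function increasing, hence recoverable from its image as the
  sorted enumeration. A decreasing pair of thresholds gives an empty interval, in agreement with
  truncated subtraction.\<close>

lemma card_transversals: "card (transversals r b) = (\<Prod>i<r. b (Suc i) - b i)"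
proof -
  have "inj_on (\<lambda>g. g ` {..<r}) (\<Pi>\<^sub>E i\<in>{..<r}. {b i<..b (Suc i)})"
  proof (rule inj_onI)
    fix g h assume gh: "g \<in> (\<Pi>\<^sub>E i\<in>{..<r}. {b i<..b (Suc i)})" "h \<in> (\<Pi>\<^sub>E i\<in>{..<r}. {b i<..b (Suc i)})"
      and eq: "g ` {..<r} = h ` {..<r}"
    have "strict_mono_on {..<r} g" "strict_mono_on {..<r} h"
      by (rule strict_mono_on_interlaced[where b = b]; use gh in \<open>auto simp: PiE_iff\<close>)+
    then have "g i = h i" if "i < r" for i
      using nth_vertex_eqI[of r g "g ` {..<r}" i] nth_vertex_eqI[of r h "g ` {..<r}" i] that eq by simp
    then show "g = h" by (intro PiE_ext[OF gh]) auto
  qed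
  then show ?thesis by (simp add: transversals_def card_image card_PiE)
qed

text \<open>The interval lengths telescope to at most \<open>r * n\<close>, so their arithmetic mean
  is at most \<open>n\<close>, and so is their geometric mean.\<close>

lemma card_transversals_le_power:
  assumes r: "r \<ge> 1" and mono: "\<And>i. i < r \<Longrightarrow> b i \<le> b (Suc i)" and br: "b r \<le> r * n"
  shows "card (transversals r b) \<le> n ^ r"
proof -
  define x where "x i = real (b (Suc i) - b i)" for i
  have "(\<Sum>i<r. x i) = (\<Sum>i<r. real (b (Suc i)) - real (b i))"
    using mono by (intro sum.cong) (auto simp: x_def of_nat_diff)
  also have "\<dots> = real (b r) - real (b 0)"
    by (induction r) auto
  also have "\<dots> \<le> real r * real n"
    using br by (metis of_nat_le_iff of_nat_mult of_nat_0_le_iff diff_le_eq add_increasing2)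
  finally have sum: "(\<Sum>i<r. x i) / real r \<le> real n"
    using r by (simp add: field_simps)
  have "(\<Prod>i<r. x i) powr (1 / real r) \<le> (\<Sum>i<r. x i / real r)"
    using arith_geom_mean[of "{..<r}" x] r by (auto simp: x_def lessThan_empty_iff)
  also have "\<dots> \<le> real n" using sum by (simp add: sum_divide_distrib)
  finally have am: "(\<Prod>i<r. x i) powr (1 / real r) \<le> real n" .
  have "(\<Prod>i<r. x i) \<ge> 0" by (intro prod_nonneg) (auto simp: x_def)
  then have "(\<Prod>i<r. x i) = ((\<Prod>i<r. x i) powr (1 / real r)) powr real r"
    using r by (simp add: powr_powr)
  also have "\<dots> \<le> real n powr real r"
    using am by (intro powr_mono2) auto
  also have "\<dots> = real n ^ r"
    using r by (cases "n = 0") (auto simp: powr_realpow)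
  finally have "real (\<Prod>i<r. b (Suc i) - b i) \<le> real (n ^ r)"
    by (simp add: x_def)
  then have "(\<Prod>i<r. b (Suc i) - b i) \<le> n ^ r" by (simp only: of_nat_le_iff)
  then show ?thesis by (simp add: card_transversals)
qed

section \<open>Partite patterns and interlaced edges\<close>

lemma concat_pairs:
  assumes "set S \<subseteq> {[x, y], [y, x]}"
  shows "length (concat S) = 2 * length S"
    and "i < length S \<Longrightarrow> concat S ! (2 * i) = S ! i ! 0"
    and "i < length S \<Longrightarrow> concat S ! Suc (2 * i) = S ! i ! 1"
    and "x \<noteq> y \<Longrightarrow> count_list (concat S) x = length S"
    and "x \<noteq> y \<Longrightarrow> count_list (concat S) y = length S"
  using assms by (induction S arbitrary: i) (auto simp: nth_Cons split: nat.splits)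

lemma less_double_cases:
  fixes k :: nat
  assumes "k < 2 * r"
  obtains i where "i < r" "k = 2 * i" | i where "i < r" "k = Suc (2 * i)"
proof (cases "even k")
  case True
  then show ?thesis using assms that(1) by (auto elim!: evenE)
next
  case False
  then show ?thesis using assms that(2) by (auto elim!: oddE)
qed

text \<open>Pair \<open>i\<close> of the word occupies positions \<open>2 * i\<close> and
  \<open>2 * i + 1\<close> and gives one to each edge; written as images of \<open>{..<r}\<close>,
  both edges come enumerated in increasing order.\<close>

lemma letter_positions:
  assumes "length S = r" "set S \<subseteq> {[LA, LB], [LB, LA]}"
  shows "{k. k < length (concat S) \<and> concat S ! k = LA}
      = (\<lambda>i. if S ! i = [LA, LB] then 2 * i else Suc (2 * i)) ` {..<r}"
    and "{k. k < length (concat S) \<and> concat S ! k = LB}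
      = (\<lambda>i. if S ! i = [LA, LB] then Suc (2 * i) else 2 * i) ` {..<r}"
proof -
  have S: "S ! i = [LA, LB] \<or> S ! i = [LB, LA]" if "i < r" for i
    using assms that nth_mem[of i S] by blast
  have len: "length (concat S) = 2 * r" using concat_pairs(1)[OF assms(2)] assms(1) by simp
  note nth = concat_pairs(2,3)[OF assms(2), unfolded assms(1)]
  show "{k. k < length (concat S) \<and> concat S ! k = LA}
      = (\<lambda>i. if S ! i = [LA, LB] then 2 * i else Suc (2 * i)) ` {..<r}"
    using S unfolding len
    by (fastforce simp: nth image_iff elim!: less_double_cases split: if_splits)
  show "{k. k < length (concat S) \<and> concat S ! k = LB}
      = (\<lambda>i. if S ! i = [LA, LB] then Suc (2 * i) else 2 * i) ` {..<r}"
    using S unfolding len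
    by (fastforce simp: nth image_iff elim!: less_double_cases split: if_splits)
qed

text \<open>Each pair of consecutive positions \<open>2 * i\<close>, \<open>2 * i + 1\<close> of a partite word holds the
  \<open>i\<close>-th vertices of both edges, so these precede the next vertices of either edge.\<close>

lemma partite_imp_nth_vertex_less:
  assumes iso: "order_isomorphic {e, f} (pattern_matching w)" and w: "w \<in> partite_patterns r"
    and i: "Suc i < r"
  shows "nth_vertex e i < nth_vertex f (Suc i)"
proof -
  obtain S where S: "length S = r" "set S \<subseteq> {[LA, LB], [LB, LA]}" "w = concat S"
    using w by (auto simp: partite_patterns_def is_partite_def)
  define a where "a i = (if S ! i = [LA, LB] then 2 * i else Suc (2 * i))" for i
  define b where "b i = (if S ! i = [LA, LB] then Suc (2 * i) else 2 * i)" for i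
  have pm: "pattern_matching w = {a ` {..<r}, b ` {..<r}}"
    unfolding pattern_matching_def S(3) letter_positions[OF S(1,2)] a_def b_def ..
  obtain \<phi> where \<phi>: "strict_mono_on (e \<union> f) \<phi>" "{\<phi> ` e, \<phi> ` f} = {a ` {..<r}, b ` {..<r}}"
    using iso unfolding order_isomorphic_def pm by auto
  \<comment> \<open>It is open which of \<open>e\<close> and \<open>f\<close> becomes the A-edge, so
    only what both enumerations share is recorded: the \<open>i\<close>-th value is
    \<open>2 * i\<close> or \<open>2 * i + 1\<close>.\<close>
  have key: "\<exists>c. (\<forall>i. c i = 2 * i \<or> c i = Suc (2 * i)) \<and> (\<forall>i<r. nth_vertex g i \<in> g \<and> \<phi> (nth_vertex g i) = c i)"
    if "g = e \<or> g = f" for g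
  proof -
    have sm: "strict_mono_on g \<phi>"
      using \<phi>(1) that by (auto simp: strict_mono_on_def)
    have "\<exists>c. (\<forall>i. c i = 2 * i \<or> c i = Suc (2 * i)) \<and> \<phi> ` g = c ` {..<r}"
    proof -
      have "\<phi> ` g \<in> {\<phi> ` e, \<phi> ` f}" using that by blast
      then have "\<phi> ` g = a ` {..<r} \<or> \<phi> ` g = b ` {..<r}" unfolding \<phi>(2) by simp
      moreover have "\<forall>i. a i = 2 * i \<or> a i = Suc (2 * i)" "\<forall>i. b i = 2 * i \<or> b i = Suc (2 * i)"
        by (auto simp: a_def b_def)
      ultimately show ?thesis by blast
    qed
    then obtain c where c: "\<forall>i. c i = 2 * i \<or> c i = Suc (2 * i)" "\<phi> ` g = c ` {..<r}" by blast
    have cmono: "c i < c j" if "i < j" for i j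
      using c(1)[rule_format, of i] c(1)[rule_format, of j] that by auto
    have inj: "inj_on \<phi> g" using sm by (rule strict_mono_on_imp_inj_on)
    \<comment> \<open>Pulling \<open>c\<close> back along the increasing map \<open>\<phi>\<close>
      lists \<open>g\<close> in increasing order, so \<open>v\<close> is its sorted
      enumeration.\<close>
    define v where "v i = the_inv_into g \<phi> (c i)" for i
    have v: "v i \<in> g" "\<phi> (v i) = c i" if "i < r" for i
    proof -
      have "c i \<in> \<phi> ` g" using c(2) that by auto
      then show "v i \<in> g" "\<phi> (v i) = c i"
        unfolding v_def by (auto intro: the_inv_into_into[OF inj] f_the_inv_into_f[OF inj])
    qed
    have "g = v ` {..<r}"
    proof (intro equalityI subsetI)
      fix x assume x: "x \<in> g"
      then obtain i where i: "i < r" "\<phi> x = c i" using c(2) by blast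
      then have "x = v i" using inj_onD[OF inj] v[OF i(1)] x by metis
      then show "x \<in> v ` {..<r}" using i by auto
    qed (use v in auto)
    moreover have "strict_mono_on {..<r} v"
    proof (rule strict_mono_onI)
      fix i j assume ij: "i \<in> {..<r}" "j \<in> {..<r}" "i < j"
      show "v i < v j"
      proof (rule ccontr)
        assume "\<not> v i < v j"
        then have "\<phi> (v j) \<le> \<phi> (v i)"
          using strict_mono_on_leD[OF sm, of "v j" "v i"] v ij by auto
        then show False using v ij cmono[OF ij(3)] by auto
      qed
    qed
    ultimately have "nth_vertex g i = v i" if "i < r" for i
      using nth_vertex_eqI that by blast
    then show ?thesis using c(1) v by auto
  qed
  obtain c where c: "\<forall>i. c i = 2 * i \<or> c i = Suc (2 * i)"
      "\<forall>i<r. nth_vertex e i \<in> e \<and> \<phi> (nth_vertex e i) = c i"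
    using key[of e] by auto
  obtain d where d: "\<forall>i. d i = 2 * i \<or> d i = Suc (2 * i)"
      "\<forall>i<r. nth_vertex f i \<in> f \<and> \<phi> (nth_vertex f i) = d i"
    using key[of f] by auto
  \<comment> \<open>The left value is at most \<open>2 * i + 1\<close>, the right one at least
    \<open>2 * i + 2\<close>.\<close>
  have "c i < d (Suc i)"
    using c(1)[rule_format, of i] d(1)[rule_format, of "Suc i"] by auto
  then have "\<phi> (nth_vertex e i) < \<phi> (nth_vertex f (Suc i))" using c(2) d(2) i by simp
  then show ?thesis
    using strict_mono_on_leD[OF \<phi>(1), of "nth_vertex f (Suc i)" "nth_vertex e i"] c(2) d(2) i
    by (meson Suc_lessD UnI1 UnI2 not_less)
qed

text \<open>Of the two vertices in the \<open>i\<close>-th interval the smaller goes to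
  \<open>2 * i\<close> and the other to \<open>2 * i + 1\<close>, which fixes the
  \<open>i\<close>-th pair of the word. The condition \<open>g 0 < h 0\<close> makes the word start
  with A.\<close>

lemma order_isomorphic_partite_interlaced:
  assumes r: "r \<ge> 1" and g: "\<And>i. i < r \<Longrightarrow> b i < g i" "\<And>i. i < r \<Longrightarrow> g i \<le> b (Suc i)"
    and h: "\<And>i. i < r \<Longrightarrow> b i < h i" "\<And>i. i < r \<Longrightarrow> h i \<le> (b (Suc i) :: nat)"
    and ne: "\<And>i. i < r \<Longrightarrow> g i \<noteq> h i" and first: "g 0 < h 0"
  shows "\<exists>w\<in>partite_patterns r. order_isomorphic {g ` {..<r}, h ` {..<r}} (pattern_matching w)"
proof -
  define S where "S = map (\<lambda>i. if g i < h i then [LA, LB] else [LB, LA]) [0..<r]"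
  define a where "a i = (if g i < h i then 2 * i else Suc (2 * i))" for i
  define c where "c i = (if g i < h i then Suc (2 * i) else 2 * i)" for i
  have S: "length S = r" "set S \<subseteq> {[LA, LB], [LB, LA]}" by (auto simp: S_def)
  have hd: "S \<noteq> []" "hd S = [LA, LB]" using r first by (auto simp: S_def hd_map)
  have "hd (concat S) = LA" "concat S \<noteq> []" using hd by (cases S; simp)+
  then have w: "concat S \<in> partite_patterns r"
    using S hd concat_pairs(1,4,5)[OF S(2)]
    by (auto simp: partite_patterns_def is_pattern_def is_partite_def)
  have pm: "pattern_matching (concat S) = {a ` {..<r}, c ` {..<r}}"
  proof -
    have "(\<lambda>i. if S ! i = [LA, LB] then 2 * i else Suc (2 * i)) ` {..<r} = a ` {..<r}"
      "(\<lambda>i. if S ! i = [LA, LB] then Suc (2 * i) else 2 * i) ` {..<r} = c ` {..<r}"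
      by (auto simp: S_def a_def c_def intro!: image_cong)
    then show ?thesis unfolding pattern_matching_def letter_positions[OF S] by simp
  qed
  have gi: "strict_mono_on {..<r} g" and hi: "strict_mono_on {..<r} h"
    using strict_mono_on_interlaced g h by blast+
  have mono: "b k \<le> b (Suc k)" if "k < r" for k using g[OF that] by simp
  have sep: "x < y" if "i < j" "j < r" "x \<le> b (Suc i)" "b j < y" for i j x y
    using monotone_chain[where r = r and b = b and i = "Suc i" and j = j] mono that by simp
  have gh: "g i \<noteq> h j" if "i < r" "j < r" for i j
    using sep[of i j "g i" "h j"] sep[of j i "h j" "g i"] g h ne that
    by (metis less_irrefl linorder_neqE_nat)
  \<comment> \<open>By \<open>gh\<close> the two edges are disjoint, so the case split treats
    vertices of \<open>h\<close> correctly.\<close>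
  define \<phi> where "\<phi> x = (if x \<in> g ` {..<r} then a (the_inv_into {..<r} g x)
      else c (the_inv_into {..<r} h x))" for x
  have \<phi>g: "\<phi> (g i) = a i" if "i < r" for i
    using that the_inv_into_f_f[OF strict_mono_on_imp_inj_on[OF gi], of i] by (auto simp: \<phi>_def)
  have \<phi>h: "\<phi> (h i) = c i" if "i < r" for i
    using that gh[OF _ that] the_inv_into_f_f[OF strict_mono_on_imp_inj_on[OF hi], of i]
    by (force simp: \<phi>_def)
  have ac: "2 * i \<le> a i" "a i \<le> Suc (2 * i)" "2 * i \<le> c i" "c i \<le> Suc (2 * i)" for i
    by (auto simp: a_def c_def)
  have sm: "strict_mono_on (g ` {..<r} \<union> h ` {..<r}) \<phi>"
  proof (rule strict_mono_onI)
    fix x y assume x: "x \<in> g ` {..<r} \<union> h ` {..<r}" and y: "y \<in> g ` {..<r} \<union> h ` {..<r}" and xy: "x < y"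
    obtain i where i: "i < r" "x = g i \<and> \<phi> x = a i \<or> x = h i \<and> \<phi> x = c i"
      using x \<phi>g \<phi>h by auto
    obtain j where j: "j < r" "y = g j \<and> \<phi> y = a j \<or> y = h j \<and> \<phi> y = c j"
      using y \<phi>g \<phi>h by auto
    \<comment> \<open>Vertices in different intervals are ordered by the index, those in the same
      interval by the choice made in \<open>a\<close> and \<open>c\<close>.\<close>
    have "\<not> j < i"
      using sep[of j i y x] xy i j g h by auto
    moreover have "\<phi> x < \<phi> y" if "i < j"
      using that i(2) j(2) ac[of i] ac[of j] by auto
    moreover have "\<phi> x < \<phi> y" if "i = j"
      using that i(2) j(2) xy by (auto simp: a_def c_def)
    ultimately show "\<phi> x < \<phi> y" by (cases i j rule: linorder_cases) auto
  qed
  have im: "\<phi> ` g ` {..<r} = a ` {..<r}" "\<phi> ` h ` {..<r} = c ` {..<r}"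
    unfolding image_image using \<phi>g \<phi>h by (auto intro!: image_cong)
  have "order_isomorphic {g ` {..<r}, h ` {..<r}} (pattern_matching (concat S))"
    unfolding order_isomorphic_def pm
    by (rule exI[of _ \<phi>]) (use sm im strict_mono_on_imp_inj_on[OF sm] in \<open>auto simp: bij_betw_def image_Un\<close>)
  then show ?thesis using w by blast
qed

lemma transversal_pair_partite:
  assumes r: "r \<ge> 1" and "e \<in> transversals r b" "f \<in> transversals r b" and dj: "disjnt e f"
  shows "\<exists>w\<in>partite_patterns r. order_isomorphic {e, f} (pattern_matching w)"
proof -
  obtain g where g: "e = g ` {..<r}" "\<And>i. i < r \<Longrightarrow> b i < g i" "\<And>i. i < r \<Longrightarrow> g i \<le> b (Suc i)"
    using assms(2) by (rule transversalsE) blast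
  obtain h where h: "f = h ` {..<r}" "\<And>i. i < r \<Longrightarrow> b i < h i" "\<And>i. i < r \<Longrightarrow> h i \<le> b (Suc i)"
    using assms(3) by (rule transversalsE) blast
  have ne: "g i \<noteq> h i" if "i < r" for i using dj that g(1) h(1) by (force simp: disjnt_def)
  \<comment> \<open>A pattern starts with A, so the edge with the smaller first vertex takes that
    letter; the pair \<open>{e, f}\<close> is unordered.\<close>
  have "g 0 < h 0 \<or> h 0 < g 0" using ne[of 0] r by auto
  then show ?thesis
  proof
    assume "g 0 < h 0"
    then show ?thesis unfolding g(1) h(1)
      by (intro order_isomorphic_partite_interlaced[where b = b]) (use r g h ne in auto)
  next
    assume *: "h 0 < g 0"
    have "\<exists>w\<in>partite_patterns r. order_isomorphic {h ` {..<r}, g ` {..<r}} (pattern_matching w)"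
      by (intro order_isomorphic_partite_interlaced[where b = b]) (use r g h ne * in force)+
    then show ?thesis unfolding g(1) h(1) by (simp add: insert_commute)
  qed
qed

section \<open>Asymptotics of the edge probability\<close>

text \<open>The sequence is the expected number of transversal edges for \<open>r\<close> intervals
  of length \<open>n\<close>, divided by \<open>n\<close>, whence the constant of the theorem. The
  binomial coefficient splits into \<open>r\<close> factors of order \<open>n\<close>.\<close>

lemma edge_prob_limit:
  assumes r: "r \<ge> 1"
  shows "(\<lambda>n. edge_prob r n * real n ^ (r - 1)) \<longlonglongrightarrow> fact (r - 1) / real r ^ (r - 1)"
proof -
  have factor: "(\<lambda>n. real (r * n - i) / real (r - i) / real n) \<longlonglongrightarrow> real r / real (r - i)" if i: "i < r" for i
  proof -
    have "(\<lambda>n. (real r - real i * (1 / real n)) / real (r - i)) \<longlonglongrightarrow> (real r - real i * 0) / real (r - i)"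
      by (intro tendsto_intros lim_1_over_n) (use i in auto)
    moreover have "\<forall>\<^sub>F n in sequentially. (real r - real i * (1 / real n)) / real (r - i)
        = real (r * n - i) / real (r - i) / real n"
    proof (rule eventually_sequentiallyI[of 1])
      fix n :: nat assume n: "n \<ge> 1"
      \<comment> \<open>This keeps the subtraction \<open>r * n - i\<close> from being
        truncated.\<close>
      then have "i \<le> r * n" using i by (metis less_imp_le mult_le_mono2 mult.right_neutral order.trans)
      then show "(real r - real i * (1 / real n)) / real (r - i) = real (r * n - i) / real (r - i) / real n"
        using n i by (simp add: of_nat_diff field_simps)
    qed
    ultimately show ?thesis by (simp add: tendsto_cong)
  qed
  have "(\<lambda>n. \<Prod>i=0..<r. real (r * n - i) / real (r - i) / real n) \<longlonglongrightarrow> (\<Prod>i=0..<r. real r / real (r - i))"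
    by (intro tendsto_prod factor) auto
  moreover have "(\<Prod>i=0..<r. real r / real (r - i)) = real r ^ r / fact r"
    by (simp add: prod_dividef fact_prod_rev)
  moreover have "\<forall>\<^sub>F n in sequentially. (\<Prod>i=0..<r. real (r * n - i) / real (r - i) / real n)
      = real ((r * n) choose r) / real n ^ r"
  proof (rule eventually_sequentiallyI[of 1])
    fix n :: nat assume "n \<ge> 1"
    then have "real ((r * n) choose r) = (\<Prod>i=0..<r. real (r * n - i) / real (r - i))"
      by (intro binomial_altdef_of_nat) simp
    then show "(\<Prod>i=0..<r. real (r * n - i) / real (r - i) / real n) = real ((r * n) choose r) / real n ^ r"
      by (simp only: prod_dividef) simp
  qed
  ultimately have "(\<lambda>n. real ((r * n) choose r) / real n ^ r) \<longlonglongrightarrow> real r ^ r / fact r"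
    by (simp add: tendsto_cong)
  then have "(\<lambda>n. inverse (real ((r * n) choose r) / real n ^ r)) \<longlonglongrightarrow> inverse (real r ^ r / fact r)"
    by (rule tendsto_inverse) (use r in simp)
  moreover have "inverse (real ((r * n) choose r) / real n ^ r) = edge_prob r n * real n ^ (r - 1)" for n
    using r by (cases r) (auto simp: edge_prob_def)
  moreover have "inverse (real r ^ r / fact r) = fact (r - 1) / real r ^ (r - 1)"
    using r by (cases r) (simp_all del: of_nat_Suc)
  ultimately show ?thesis by simp
qed

text \<open>The normalised sequence and its shift have the same nonzero limit. This makes the
  correlation term of the variance bound negligible.\<close>

lemma edge_prob_ratio_limit:
  assumes r: "r \<ge> 1"
  shows "(\<lambda>n. edge_prob r (n - 1) / edge_prob r n) \<longlonglongrightarrow> 1"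
proof -
  let ?a = "\<lambda>n. edge_prob r n * real n ^ (r - 1)"
  let ?L = "fact (r - 1) / real r ^ (r - 1)"
  have "(\<lambda>n. ?a (n - 1)) \<longlonglongrightarrow> ?L"
    by (rule filterlim_compose[OF edge_prob_limit[OF r] filterlim_minus_const_nat_at_top])
  moreover have "(\<lambda>n. real (n - 1) / real n) \<longlonglongrightarrow> 1" by real_asymp
  ultimately have "(\<lambda>n. ?a (n - 1) / ?a n / (real (n - 1) / real n) ^ (r - 1)) \<longlonglongrightarrow> ?L / ?L / 1 ^ (r - 1)"
    by (intro tendsto_intros edge_prob_limit r) (use r in auto)
  \<comment> \<open>From \<open>n = 2\<close> on, \<open>n - 1\<close> is nonzero and the powers
    cancel.\<close>
  moreover have "\<forall>\<^sub>F n in sequentially. ?a (n - 1) / ?a n / (real (n - 1) / real n) ^ (r - 1)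
      = edge_prob r (n - 1) / edge_prob r n"
    by (rule eventually_sequentiallyI[of 2]) (simp add: power_divide)
  ultimately show ?thesis using r by (simp add: tendsto_cong)
qed

section \<open>Cliques and transversals\<close>

lemma transversals_clique:
  assumes "r \<ge> 1" "ordered_matching r M"
  shows "pattern_clique r (partite_patterns r) (M \<inter> transversals r b)"
  using assms transversal_pair_partite[of r _ b]
  by (auto simp: pattern_clique_def ordered_matching_def pairwise_def)

text \<open>Cutting after the largest \<open>k\<close>-th vertex of the clique, for each
  \<open>k\<close>, makes every edge a transversal. Rounding the cuts down to multiples of
  \<open>s\<close> loses an edge only if one of its vertices falls into one of \<open>r\<close> gaps
  shorter than \<open>s\<close>, and disjoint edges use different vertices.\<close>

lemma clique_nearly_transversal:
  assumes r: "r \<ge> 1" and s: "s \<ge> 1" and N: "pattern_clique r (partite_patterns r) N"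
    and V: "\<Union>N \<subseteq> {1..r * n}"
  obtains j where "j \<in> {..r} \<rightarrow>\<^sub>E {..r * n div s}" "\<And>i. i < r \<Longrightarrow> j i \<le> j (Suc i)"
    "card N \<le> card (N \<inter> transversals r (\<lambda>i. s * j i)) + r * s"
proof (cases "N = {}")
  case True
  \<comment> \<open>\<open>Max\<close> of an empty set carries no information, so the empty clique
    gets constant thresholds.\<close>
  show ?thesis by (rule that[of "\<lambda>i\<in>{..r}. 0"]) (use True in auto)
next
  case False
  have om: "finite N" "pairwise disjnt N" "\<And>e. e \<in> N \<Longrightarrow> finite e" "\<And>e. e \<in> N \<Longrightarrow> card e = r"
    using N by (auto simp: pattern_clique_def ordered_matching_def)
  define t where "t i = (case i of 0 \<Rightarrow> 0 | Suc k \<Rightarrow> Max ((\<lambda>e. nth_vertex e k) ` N))" for i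
  have t0: "t 0 = 0" and tSuc: "t (Suc k) = Max ((\<lambda>e. nth_vertex e k) ` N)" for k
    by (auto simp: t_def)
  have mem: "nth_vertex e i \<in> e" if "e \<in> N" "i < r" for e i
    using nth_vertex_mem om that by metis
  have rng: "nth_vertex e i \<in> {1..r * n}" if "e \<in> N" "i < r" for e i
    using mem[OF that] V that by blast
  have upper: "nth_vertex e i \<le> t (Suc i)" if "e \<in> N" for e i
    unfolding tSuc using that om(1) by (intro Max_ge) auto
  have less: "nth_vertex f i < nth_vertex e (Suc i)" if "e \<in> N" "f \<in> N" "Suc i < r" for e f i
  proof (cases "e = f")
    case True
    have "sorted_wrt (<) (sorted_list_of_set e)" "Suc i < length (sorted_list_of_set e)"
      using om that by auto
    then show ?thesis using True by (auto simp: sorted_wrt_iff_nth_less)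
  next
    case False
    then show ?thesis
      using N that partite_imp_nth_vertex_less[of f e _ r i] by (auto simp: pattern_clique_def)
  qed
  \<comment> \<open>By interlacing, \<open>nth_vertex e i\<close> exceeds all vertices of index
    \<open>i - 1\<close> and so their maximum \<open>t i\<close>. For \<open>i = 0\<close> the value
    \<open>t 0 = 0\<close> works because vertices start at 1.\<close>
  have lower: "t i < nth_vertex e i" if "e \<in> N" "i < r" for e i
  proof (cases i)
    case 0
    then show ?thesis using rng[OF that] t0 by simp
  next
    case (Suc k)
    then show ?thesis
      unfolding Suc tSuc using om(1) False less[OF that(1)] that(2) Suc by (subst Max_less_iff) auto
  qed
  obtain e0 where e0: "e0 \<in> N" using False by blast
  have tmono: "t i \<le> t (Suc i)" if "i < r" for i
    using lower[OF e0 that] upper[OF e0, of i] by simp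
  have tle: "t i \<le> r * n" if "i \<le> r" for i
  proof (cases i)
    case (Suc k)
    then show ?thesis
      unfolding Suc tSuc using om(1) False rng that Suc by (subst Max_le_iff) auto
  qed (simp add: t0)
  \<comment> \<open>The restriction to \<open>{..r}\<close> puts \<open>j\<close> into a finite
    function space, as a union bound requires.\<close>
  define j where "j = (\<lambda>i\<in>{..r}. t i div s)"
  define b where "b i = s * j i" for i
  have bt: "b i \<le> t i" "t i < b i + s" if "i \<le> r" for i
    using s that dividend_less_times_div[of s "t i"] by (simp_all add: b_def j_def add.commute)
  \<comment> \<open>The edges lost by rounding the upper threshold of interval \<open>i\<close>.
    Lower bounds survive, since thresholds are rounded down.\<close>
  define B where "B i = {e \<in> N. nth_vertex e i \<in> {b (Suc i)<..t (Suc i)}}" for i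
  have cB: "card (B i) \<le> s" if i: "i < r" for i
  proof -
    have "card (B i) \<le> card {b (Suc i)<..t (Suc i)}"
    proof (rule card_inj_on_le[where f = "\<lambda>e. nth_vertex e i"])
      show "inj_on (\<lambda>e. nth_vertex e i) (B i)"
      proof (rule inj_onI)
        fix e f assume "e \<in> B i" "f \<in> B i" and eq: "nth_vertex e i = nth_vertex f i"
        then have ef: "e \<in> N" "f \<in> N" by (auto simp: B_def)
        then have "nth_vertex e i \<in> e \<inter> f" using mem[OF ef(1) i] mem[OF ef(2) i] eq by simp
        then show "e = f" using ef om(2) by (auto simp: pairwise_def disjnt_def)
      qed
    qed (auto simp: B_def)
    also have "\<dots> \<le> s" using bt[of "Suc i"] i by simp
    finally show ?thesis .
  qed
  have "N \<subseteq> (N \<inter> transversals r b) \<union> (\<Union>i<r. B i)"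
  proof
    fix e assume e: "e \<in> N"
    show "e \<in> (N \<inter> transversals r b) \<union> (\<Union>i<r. B i)"
    proof (cases "\<exists>i<r. e \<in> B i")
      case False
      have "nth_vertex e ` {..<r} \<in> transversals r b"
      proof (rule transversalsI)
        fix i assume i: "i < r"
        have "b i < nth_vertex e i" using lower[OF e i] bt(1)[of i] i by simp
        moreover have "nth_vertex e i \<le> b (Suc i)"
          using False i e upper[OF e, of i] by (fastforce simp: B_def not_less)
        ultimately show "nth_vertex e i \<in> {b i<..b (Suc i)}" by simp
      qed
      then show ?thesis using nth_vertex_image[of e] om(3,4)[OF e] e by simp
    qed auto
  qed
  then have "card N \<le> card ((N \<inter> transversals r b) \<union> (\<Union>i<r. B i))"
    using om(1) by (intro card_mono) (auto simp: B_def)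
  also have "\<dots> \<le> card (N \<inter> transversals r b) + card (\<Union>i<r. B i)"
    by (rule card_Un_le)
  also have "card (\<Union>i<r. B i) \<le> (\<Sum>i<r. card (B i))"
    by (rule card_UN_le) simp
  also have "\<dots> \<le> (\<Sum>i<r. s)" by (intro sum_mono cB) auto
  finally have "card N \<le> card (N \<inter> transversals r b) + r * s" by simp
  then have "card N \<le> card (N \<inter> transversals r (\<lambda>i. s * j i)) + r * s"
    by (simp add: b_def[abs_def])
  moreover have "j \<in> {..r} \<rightarrow>\<^sub>E {..r * n div s}"
    using tle by (auto simp: j_def intro: div_le_mono)
  moreover have "j i \<le> j (Suc i)" if "i < r" for i
    using tmono[OF that] that by (auto simp: j_def intro: div_le_mono)
  ultimately show ?thesis using that by blast
qed

text \<open>The empty set is a clique, so the maximum ranges over a nonempty finite set and is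
  attained.\<close>

lemma max_clique_size_is_max:
  assumes "finite M"
  shows "N \<subseteq> M \<Longrightarrow> pattern_clique r P N \<Longrightarrow> card N \<le> max_clique_size r P M"
    and "\<exists>N\<subseteq>M. pattern_clique r P N \<and> card N = max_clique_size r P M"
proof -
  let ?C = "{card N |N. N \<subseteq> M \<and> pattern_clique r P N}"
  have fin: "finite ?C"
    by (rule finite_subset[of _ "card ` Pow M"]) (use assms in auto)
  show "N \<subseteq> M \<Longrightarrow> pattern_clique r P N \<Longrightarrow> card N \<le> max_clique_size r P M"
    unfolding max_clique_size_def by (rule Max_ge[OF fin]) auto
  have "pattern_clique r P {}" by (simp add: pattern_clique_def ordered_matching_def)
  then have "?C \<noteq> {}" by blast
  then have "Max ?C \<in> ?C" by (rule Max_in[OF fin])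
  then show "\<exists>N\<subseteq>M. pattern_clique r P N \<and> card N = max_clique_size r P M"
    unfolding max_clique_size_def by auto
qed

section \<open>Clique size outside the deviation events\<close>

definition deviates :: "nat \<Rightarrow> nat \<Rightarrow> real \<Rightarrow> (nat \<Rightarrow> nat) \<Rightarrow> nat set set \<Rightarrow> bool" where
  "deviates r n \<delta> b M \<longleftrightarrow>
     \<bar>real (card (M \<inter> transversals r b)) - real (card (transversals r b)) * edge_prob r n\<bar> > \<delta> * real n"

lemma prob_deviates_le:
  assumes "r \<ge> 1" "n \<ge> 2" "\<delta> > 0" "b r \<le> r * n"
  shows "measure_pmf.prob (random_matching r n) {M. deviates r n \<delta> b M}
    \<le> (1 / real n + \<bar>edge_prob r (n - 1) / edge_prob r n - 1\<bar>) / \<delta>\<^sup>2"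
  unfolding deviates_def
  by (rule prob_deviation_le) (use assms transversals_subset in auto)

text \<open>The equal intervals given by \<open>i * n\<close> have \<open>n ^ r\<close>
  transversals, and those that are edges of \<open>M\<close> form a clique.\<close>

lemma max_clique_size_lower:
  assumes r: "r \<ge> 1" and M: "M \<in> matchings r n" and dev: "\<not> deviates r n \<delta> (\<lambda>i. i * n) M"
  shows "real n ^ r * edge_prob r n - \<delta> * real n \<le> real (max_clique_size r (partite_patterns r) M)"
proof -
  let ?T = "transversals r (\<lambda>i. i * n)"
  have "ordered_matching r M" "finite M"
    using M by (auto simp: matchings_def ordered_matching_def)
  then have "card (M \<inter> ?T) \<le> max_clique_size r (partite_patterns r) M"
    by (intro max_clique_size_is_max transversals_clique r) auto
  moreover have "real (card ?T) = real n ^ r"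
    by (simp add: card_transversals diff_mult_distrib[symmetric])
  ultimately show ?thesis
    using dev by (simp add: deviates_def abs_if split: if_splits)
qed

text \<open>Up to \<open>r * s\<close> edges, a largest clique consists of transversals for one
  rounded threshold sequence, whose expected number is controlled by AM-GM. The sequence depends on
  \<open>M\<close>, so all candidates are assumed not to deviate.\<close>

lemma max_clique_size_upper:
  assumes r: "r \<ge> 1" and s: "s \<ge> 1" and M: "M \<in> matchings r n"
    and dev: "\<And>j. j \<in> {..r} \<rightarrow>\<^sub>E {..r * n div s} \<Longrightarrow> \<not> deviates r n \<delta> (\<lambda>i. s * j i) M"
  shows "real (max_clique_size r (partite_patterns r) M)
    \<le> real n ^ r * edge_prob r n + \<delta> * real n + real (r * s)"
proof -
  have fin: "finite M" and V: "\<Union>M = {1..r * n}"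
    using M by (auto simp: matchings_def ordered_matching_def)
  obtain N where N: "N \<subseteq> M" "pattern_clique r (partite_patterns r) N"
    "card N = max_clique_size r (partite_patterns r) M"
    using max_clique_size_is_max(2)[OF fin] by blast
  have "\<Union>N \<subseteq> {1..r * n}" using N(1) V by blast
  from clique_nearly_transversal[OF r s N(2) this] obtain j where
    j: "j \<in> {..r} \<rightarrow>\<^sub>E {..r * n div s}" "\<And>i. i < r \<Longrightarrow> j i \<le> j (Suc i)"
      "card N \<le> card (N \<inter> transversals r (\<lambda>i. s * j i)) + r * s"
    by blast
  let ?T = "transversals r (\<lambda>i. s * j i)"
  have "j r \<le> r * n div s" using j(1) by auto
  then have jr: "s * j r \<le> r * n"
    by (metis mult_le_mono2 times_div_less_eq_dividend order.trans)
  have "card (N \<inter> ?T) \<le> card (M \<inter> ?T)"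
    by (rule card_mono) (use fin N(1) in auto)
  moreover have "real (card ?T) * edge_prob r n \<le> real n ^ r * edge_prob r n"
  proof (rule mult_right_mono)
    have "card ?T \<le> n ^ r"
      by (rule card_transversals_le_power[OF r]) (use j(2) jr in auto)
    then show "real (card ?T) \<le> real n ^ r" by (metis of_nat_le_iff of_nat_power)
  qed (simp add: edge_prob_def)
  moreover have "real (card N) \<le> real (card (N \<inter> ?T)) + real (r * s)"
    using j(3) by (metis of_nat_add of_nat_le_iff)
  ultimately show ?thesis
    using dev[OF j(1)] N(3) by (simp add: deviates_def abs_if split: if_splits)
qed

section \<open>Convergence in probability\<close>

text \<open>For fixed \<open>K\<close> the number of rounded threshold sequences stays bounded as
  \<open>n\<close> grows, so a union bound over events of vanishing probability suffices.\<close>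

lemma max_clique_size_tendsto_in_prob:
  assumes r: "r \<ge> 1"
  shows "tendsto_in_prob (random_matching r)
           (\<lambda>n M. real (max_clique_size r (partite_patterns r) M) / real n)
           (fact (r - 1) / real r ^ (r - 1))"
  unfolding tendsto_in_prob_def
proof (intro allI impI)
  fix \<epsilon> :: real assume \<epsilon>: "\<epsilon> > 0"
  let ?L = "fact (r - 1) / real r ^ (r - 1)"
  let ?z = "\<lambda>M. real (max_clique_size r (partite_patterns r) M)"
  let ?a = "\<lambda>n. edge_prob r n * real n ^ (r - 1)"
  \<comment> \<open>One share is spent on the limit of \<open>?a\<close>, one on the deviation, and
    two on rounding.\<close>
  define \<delta> where "\<delta> = \<epsilon> / 4"
  have \<delta>: "\<delta> > 0" using \<epsilon> by (simp add: \<delta>_def)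
  \<comment> \<open>Rounding in steps of about \<open>n / K\<close> costs about
    \<open>r * n / K\<close> edges, which this \<open>K\<close> keeps below
    \<open>\<delta> * n\<close>.\<close>
  obtain K :: nat where K0: "real r / \<delta> < real K" using reals_Archimedean2 by blast
  moreover have "real r / \<delta> > 0" using r \<delta> by simp
  ultimately have K: "K \<ge> 1" by (cases K) auto
  have rK: "real r / real K \<le> \<delta>" using K0 K \<delta> by (simp add: field_simps)
  define J where "J = {..r} \<rightarrow>\<^sub>E {..r * K}"
  have finJ: "finite J" unfolding J_def by (intro finite_PiE) auto
  define c where "c n = (1 / real n + \<bar>edge_prob r (n - 1) / edge_prob r n - 1\<bar>) / \<delta>\<^sup>2" for n
  \<comment> \<open>The added 1 counts the event for equal intervals used in the lower
    bound.\<close>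
  have "(\<lambda>n. real (card J + 1) * c n) \<longlonglongrightarrow> real (card J + 1) * ((0 + \<bar>1 - 1\<bar>) / \<delta>\<^sup>2)"
    unfolding c_def by (intro tendsto_intros lim_1_over_n edge_prob_ratio_limit r) (use \<delta> in auto)
  then have lim: "(\<lambda>n. real (card J + 1) * c n) \<longlonglongrightarrow> 0" by simp
  have "\<forall>\<^sub>F n in sequentially. dist (?a n) ?L < \<delta>"
    by (rule tendstoD[OF edge_prob_limit[OF r] \<delta>])
  moreover have "\<forall>\<^sub>F n in sequentially. real r / real n < \<delta>"
    by (rule order_tendstoD(2)[OF lim_const_over_n \<delta>])
  moreover have "\<forall>\<^sub>F n in sequentially. n \<ge> 2" by (rule eventually_ge_at_top)
  ultimately have ev: "\<forall>\<^sub>F n in sequentially.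
      measure_pmf.prob (random_matching r n) {M. \<bar>?z M / real n - ?L\<bar> > \<epsilon>} \<le> real (card J + 1) * c n"
  proof eventually_elim
    case (elim n)
    then have a: "\<bar>?a n - ?L\<bar> < \<delta>" and rn: "real r / real n < \<delta>" and n: "n \<ge> 2"
      by (auto simp: dist_real_def)
    \<comment> \<open>The added 1 makes \<open>s\<close> positive and \<open>n < K * s\<close>, so
      multiples of \<open>s\<close> up to \<open>r * n\<close> have index at most
      \<open>r * K\<close>; its cost \<open>r / n\<close> is the second rounding share.\<close>
    define s where "s = n div K + 1"
    have s: "s \<ge> 1" by (simp add: s_def)
    have "n < K * s" using K dividend_less_times_div[of K n] by (simp add: s_def algebra_simps)
    then have "r * n div s \<le> r * K"
      using s by (metis div_le_mono less_imp_le mult_le_mono2 mult.assoc nonzero_mult_div_cancel_right not_one_le_zero)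
    then have sub: "{..r} \<rightarrow>\<^sub>E {..r * n div s} \<subseteq> J"
      unfolding J_def by (intro PiE_mono) auto
    let ?J = "{..r} \<rightarrow>\<^sub>E {..r * n div s}"
    have finJ': "finite ?J" and cJ: "card ?J \<le> card J"
      using finite_subset[OF sub finJ] card_mono[OF finJ sub] by auto
    let ?P = "measure_pmf.prob (random_matching r n)"
    let ?E = "{M. deviates r n \<delta> (\<lambda>i. i * n) M} \<union> (\<Union>j\<in>?J. {M. deviates r n \<delta> (\<lambda>i. s * j i) M})"
    have npow: "real n ^ r = real n * real n ^ (r - 1)"
      using r by (metis power_eq_if not_one_le_zero)
    have "real s \<le> real n / real K + 1"
      unfolding s_def using of_nat_div_le_of_nat[of n K] by simp
    then have "real r * real s \<le> real r * (real n / real K + 1)" by (rule mult_left_mono) simp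
    also have "\<dots> = (real r / real K + real r / real n) * real n"
      using n by (simp add: field_simps)
    also have "\<dots> \<le> (\<delta> + \<delta>) * real n"
      using rK rn by (intro mult_right_mono) auto
    finally have rs: "real (r * s) \<le> 2 * \<delta> * real n" by simp
    \<comment> \<open>The bounds on the clique size concern members of \<open>matchings r n\<close>,
      so the event is first cut down to the support.\<close>
    have "{M. \<bar>?z M / real n - ?L\<bar> > \<epsilon>} \<inter> matchings r n \<subseteq> ?E"
    proof (rule subsetI, rule ccontr)
      fix M assume M: "M \<in> {M. \<bar>?z M / real n - ?L\<bar> > \<epsilon>} \<inter> matchings r n" and "M \<notin> ?E"
      then have "real n ^ r * edge_prob r n - \<delta> * real n \<le> ?z M"
        "?z M \<le> real n ^ r * edge_prob r n + \<delta> * real n + real (r * s)"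
        using max_clique_size_lower[OF r, of M n \<delta>] max_clique_size_upper[OF r s, of M n \<delta>] by auto
      then have "(?a n - \<delta>) * real n \<le> ?z M" "?z M \<le> (?a n + 3 * \<delta>) * real n"
        using rs by (auto simp: npow algebra_simps)
      then have "?a n - \<delta> \<le> ?z M / real n" "?z M / real n \<le> ?a n + 3 * \<delta>"
        using n by (auto simp: pos_le_divide_eq pos_divide_le_eq)
      then have "\<bar>?z M / real n - ?L\<bar> \<le> 4 * \<delta>" using a \<delta> by linarith
      then show False using M by (simp add: \<delta>_def)
    qed
    moreover have "set_pmf (random_matching r n) = matchings r n"
      unfolding random_matching_def
      by (rule set_pmf_of_set) (use finite_matchings matchings_nonempty[OF r] in auto)
    ultimately have "{M. \<bar>?z M / real n - ?L\<bar> > \<epsilon>} \<inter> set_pmf (random_matching r n) \<subseteq> ?E"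
      by simp
    then have "?P ({M. \<bar>?z M / real n - ?L\<bar> > \<epsilon>} \<inter> set_pmf (random_matching r n)) \<le> ?P ?E"
      by (rule measure_pmf.finite_measure_mono) simp
    then have "?P {M. \<bar>?z M / real n - ?L\<bar> > \<epsilon>} \<le> ?P ?E"
      unfolding measure_Int_set_pmf .
    also have "\<dots> \<le> ?P {M. deviates r n \<delta> (\<lambda>i. i * n) M}
        + ?P (\<Union>j\<in>?J. {M. deviates r n \<delta> (\<lambda>i. s * j i) M})"
      by (rule measure_Un_le) auto
    also have "\<dots> \<le> c n + (\<Sum>j\<in>?J. ?P {M. deviates r n \<delta> (\<lambda>i. s * j i) M})"
      using prob_deviates_le[OF r n \<delta>, of "\<lambda>i. i * n"] finJ'
      by (intro add_mono measure_UNION_le) (auto simp: c_def)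
    also have "\<dots> \<le> c n + (\<Sum>j\<in>?J. c n)"
    proof (intro add_left_mono sum_mono)
      fix j assume "j \<in> ?J"
      then have "j r \<le> r * n div s" by auto
      then have "s * j r \<le> r * n"
        by (metis mult_le_mono2 times_div_less_eq_dividend order.trans)
      then show "?P {M. deviates r n \<delta> (\<lambda>i. s * j i) M} \<le> c n"
        unfolding c_def by (rule prob_deviates_le[OF r n \<delta>])
    qed
    also have "\<dots> \<le> real (card J + 1) * c n"
    proof -
      have "c n \<ge> 0" by (simp add: c_def)
      then have "real (card ?J) * c n \<le> real (card J) * c n"
        using cJ by (intro mult_right_mono) auto
      then show ?thesis by (simp add: algebra_simps)
    qed
    finally show ?case .
  qed
  show "(\<lambda>n. measure_pmf.prob (random_matching r n) {M. \<bar>?z M / real n - ?L\<bar> > \<epsilon>}) \<longlonglongrightarrow> 0"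
    by (rule tendsto_sandwich[OF _ ev tendsto_const lim]) (simp add: eventually_sequentially)
qed

lemma tendsto_in_prob_imp_asymp_equiv:
  assumes "tendsto_in_prob p (\<lambda>n x. X n x / real n) c" "c > 0"
  shows "asymp_equiv_in_prob p X (\<lambda>n. c * real n)"
  unfolding asymp_equiv_in_prob_def tendsto_in_prob_def
proof (intro allI impI)
  fix \<epsilon> :: real assume "\<epsilon> > 0"
  then have "(\<lambda>n. measure_pmf.prob (p n) {x. \<bar>X n x / real n - c\<bar> > c * \<epsilon>}) \<longlonglongrightarrow> 0"
    using assms by (simp add: tendsto_in_prob_def)
  moreover have "\<bar>X n x / (c * real n) - 1\<bar> > \<epsilon> \<longleftrightarrow> \<bar>X n x / real n - c\<bar> > c * \<epsilon>" for n x
  proof -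
    \<comment> \<open>At \<open>n = 0\<close> both quotients are 0 by convention, and the identity
      still holds.\<close>
    have "X n x / real n - c = c * (X n x / (c * real n) - 1)"
      using assms(2) by (simp add: right_diff_distrib)
    then show ?thesis using assms(2) by (simp add: abs_mult)
  qed
  ultimately show "(\<lambda>n. measure_pmf.prob (p n) {x. \<bar>X n x / (c * real n) - 1\<bar> > \<epsilon>}) \<longlonglongrightarrow> 0"
    by simp
qed

theorem theorem2p1:
  fixes r :: nat
  assumes "r \<ge> 2"
  shows "tendsto_in_prob (random_matching r)
           (\<lambda>n M. real (max_clique_size r (partite_patterns r) M) / real n)
           (fact (r - 1) / real r ^ (r - 1))
       \<and> asymp_equiv_in_prob (random_matching r)
           (\<lambda>n M. real (max_clique_size r (partite_patterns r) M))
           (\<lambda>n. fact (r - 1) / real r ^ (r - 1) * real n)"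
proof
  show *: "tendsto_in_prob (random_matching r)
           (\<lambda>n M. real (max_clique_size r (partite_patterns r) M) / real n)
           (fact (r - 1) / real r ^ (r - 1))"
    by (rule max_clique_size_tendsto_in_prob) (use assms in simp)
  show "asymp_equiv_in_prob (random_matching r)
           (\<lambda>n M. real (max_clique_size r (partite_patterns r) M))
           (\<lambda>n. fact (r - 1) / real r ^ (r - 1) * real n)"
    by (rule tendsto_in_prob_imp_asymp_equiv[OF *]) (use assms in simp)
qed

end
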